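(* The metric $\lambda_{\mathbb{B}^2}^{-1}$ on the unit disk $\mathbb{B}^2$ is not Hölder continuous with respect to the hyperbolic metric $\rho_{\mathbb{B}^2}$; that is, there do not exist constants $C>0$ and $\alpha>0$ such that $\lambda_{\mathbb{B}^2}(x,y)^{-1}\le C\,\rho_{\mathbb{B}^2}(x,y)^{\alpha}$ for all distinct $x,y\in\mathbb{B}^2$.
   Context: $\mathbb{B}^2=\{x\in\mathbb{R}^2:|x|<1\}$. Modulus of a curve family: for a family $\Gamma$ of curves in $\mathbb{R}^2$, $\mathsf{M}(\Gamma)=\inf_{\sigma}\int_{\mathbb{R}^2}\sigma^2\,dm$, where $m$ is Lebesgue measure and the infimum is over all Borel functions $\sigma:\mathbb{R}^2\to[0,\infty]$ with $\int_\gamma\sigma\,ds\ge 1$ for every locally rectifiable curve $\gamma\in\Gamma$. For nonempty sets $E,F$ and a domain $G$, $\Delta(E,F;G)$ is the family of all curves joining $E$ and $F$ in $G$ (one endpoint in $E$, the other in $F$, and all non-endpoint points of the curve in $G$). For a domain $G$ and distinct $x,y\in G$, $\lambda_G(x,y)=\inf_{C_x,C_y}\mathsf{M}(\Delta(C_x,C_y;G))$, where the infimum is over all pairs of continua $C_x,C_y$ in $\overline{G}$ with $x\in C_x$, $y\in C_y$, $\overline{C_x}\cap\partial G\ne\varnothing$ and $\overline{C_y}\cap\partial G\neq\varnothing$. With the convention that $\lambda_{\mathbb{B}^2}^{-1}(x,x)=0$, the function $\lambda_{\mathbb{B}^2}^{-1}=1/\lambda_{\mathbb{B}^2}$ is a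 metric on $\mathbb{B}^2$. Hyperbolic metric: $\sinh^2(\rho_{\mathbb{B}^2}(x,y)/2)=\dfrac{|x-y|^2}{(1-|x|^2)(1-|y|^2)}$ for $x,y\in\mathbb{B}^2$. *)

theory Defs
  imports "HOL-Analysis.Analysis"
begin

text \<open>
  Curves are continuous maps on the unit interval (\<^const>\<open>path\<close>). The curves of \<open>Delta E F G\<close> contain
  their endpoints, so every one of them has such a parametrization, and for a curve on a compact
  interval local rectifiability is the same as rectifiability.
\<close>

definition curve_length :: "(real \<Rightarrow> 'a::metric_space) \<Rightarrow> real \<Rightarrow> real \<Rightarrow> ennreal" where
  "curve_length \<gamma> a b =
     (SUP ts \<in> {ts. sorted ts \<and> set ts \<subseteq> {a..b}}.
        \<Sum>i<length ts - 1. ennreal (dist (\<gamma> (ts ! i)) (\<gamma> (ts ! Suc i))))"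

definition rectifiable :: "(real \<Rightarrow> 'a::metric_space) \<Rightarrow> bool" where
  "rectifiable \<gamma> \<longleftrightarrow> path \<gamma> \<and> curve_length \<gamma> 0 1 < \<infinity>"

text \<open>
  For a rectifiable \<open>\<gamma>\<close> and \<open>u\<close> between \<open>0\<close> and its length, a parameter \<open>t\<close> as below exists, and two
  such parameters give the same point, since \<open>\<gamma>\<close> is constant wherever its length function is.
\<close>

definition arclength_param :: "(real \<Rightarrow> 'a::metric_space) \<Rightarrow> real \<Rightarrow> 'a" where
  "arclength_param \<gamma> u = \<gamma> (SOME t. t \<in> {0..1} \<and> curve_length \<gamma> 0 t = ennreal u)"

text \<open>Only meaningful for rectifiable \<open>\<gamma>\<close>.\<close>

definition line_integral :: "('a::metric_space \<Rightarrow> ennreal) \<Rightarrow> (real \<Rightarrow> 'a) \<Rightarrow> ennreal" where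
  "line_integral \<sigma> \<gamma> =
     (\<integral>\<^sup>+ u \<in> {0..enn2real (curve_length \<gamma> 0 1)}. \<sigma> (arclength_param \<gamma> u) \<partial>lborel)"

definition admissible :: "(real \<Rightarrow> real ^ 2) set \<Rightarrow> (real ^ 2 \<Rightarrow> ennreal) \<Rightarrow> bool" where
  "admissible \<Gamma> \<sigma> \<longleftrightarrow>
     \<sigma> \<in> borel_measurable borel \<and> (\<forall>\<gamma>\<in>\<Gamma>. rectifiable \<gamma> \<longrightarrow> 1 \<le> line_integral \<sigma> \<gamma>)"

definition modulus :: "(real \<Rightarrow> real ^ 2) set \<Rightarrow> ennreal" where
  "modulus \<Gamma> = (INF \<sigma> \<in> {\<sigma>. admissible \<Gamma> \<sigma>}. \<integral>\<^sup>+ z. (\<sigma> z)\<^sup>2 \<partial>lborel)"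

definition Delta :: "'a::topological_space set \<Rightarrow> 'a set \<Rightarrow> 'a set \<Rightarrow> (real \<Rightarrow> 'a) set" where
  "Delta E F G =
     {\<gamma>. path \<gamma> \<and>
         (pathstart \<gamma> \<in> E \<and> pathfinish \<gamma> \<in> F \<or> pathstart \<gamma> \<in> F \<and> pathfinish \<gamma> \<in> E) \<and>
         \<gamma> ` {0<..<1} \<subseteq> G}"

definition continuum :: "'a::topological_space set \<Rightarrow> bool" where
  "continuum C \<longleftrightarrow> compact C \<and> connected C \<and> C \<noteq> {}"

definition lambda_mod :: "(real ^ 2) set \<Rightarrow> real ^ 2 \<Rightarrow> real ^ 2 \<Rightarrow> ennreal" where
  "lambda_mod G x y =
     (INF (Cx, Cy) \<in> {(Cx, Cy).
         continuum Cx \<and> continuum Cy \<and> Cx \<subseteq> closure G \<and> Cy \<subseteq> closure G \<and> x \<in> Cx \<and> y \<in> Cy \<and>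
         closure Cx \<inter> frontier G \<noteq> {} \<and> closure Cy \<inter> frontier G \<noteq> {}}.
       modulus (Delta Cx Cy G))"

text \<open>With values in \<^typ>\<open>ennreal\<close>, where \<open>inverse 0 = \<infinity>\<close> and \<open>inverse \<infinity> = 0\<close>.\<close>

definition lambda_inv :: "(real ^ 2) set \<Rightarrow> real ^ 2 \<Rightarrow> real ^ 2 \<Rightarrow> ennreal" where
  "lambda_inv G x y = (if x = y then 0 else inverse (lambda_mod G x y))"

definition hyp_dist :: "real ^ 2 \<Rightarrow> real ^ 2 \<Rightarrow> real" where
  "hyp_dist x y = 2 * arsinh (norm (x - y) / sqrt ((1 - (norm x)\<^sup>2) * (1 - (norm y)\<^sup>2)))"

lemma hyp_dist_nonneg:
  assumes "x \<in> ball 0 1" "y \<in> ball 0 1"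
  shows "0 \<le> hyp_dist x y"
proof -
  have "(norm x)\<^sup>2 \<le> 1" "(norm y)\<^sup>2 \<le> 1"
    using assms by (simp_all add: power_le_one)
  then have "0 \<le> norm (x - y) / sqrt ((1 - (norm x)\<^sup>2) * (1 - (norm y)\<^sup>2))"
    by simp
  then show ?thesis
    unfolding hyp_dist_def using arsinh_real_neg_iff by (meson mult_nonneg_nonneg not_less zero_le_numeral)
qed

lemma sinh_hyp_dist:
  assumes "x \<in> ball 0 1" "y \<in> ball 0 1"
  shows "(sinh (hyp_dist x y / 2))\<^sup>2 =
           (norm (x - y))\<^sup>2 / ((1 - (norm x)\<^sup>2) * (1 - (norm y)\<^sup>2))"
proof -
  have "(norm x)\<^sup>2 \<le> 1" "(norm y)\<^sup>2 \<le> 1"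
    using assms by (simp_all add: power_le_one)
  then show ?thesis
    unfolding hyp_dist_def by (simp add: power_divide)
qed

end

theory Submission
  imports Defs
begin

text \<open>
  Near the centre of the disk the metric \<open>1/\<lambda>\<close> decays only like the reciprocal of a logarithm,
  whereas the hyperbolic metric is comparable to the Euclidean one; no power of the latter can
  dominate the former.

  In detail, take the antipodal points \<open>\<plusminus> r e\<close> with \<open>r = 2\<^sup>-\<^sup>n\<close> and a unit vector \<open>e\<close>. The hyperbolic
  distance is at most \<open>6 r\<close> (\<open>hyp_dist_antipodal_le\<close>). For \<open>\<lambda>\<close> an upper bound is needed, and since
  both \<open>\<lambda>\<close> and the modulus are infima, one pair of continua and one density suffice
  (\<open>lambda_mod_antipodal_le\<close>). The continua are the opposite radial segments from \<open>\<plusminus> r e\<close> to the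
  circle, and the density is \<open>\<sigma>(z) = 3/|z|\<close>, cut off near \<open>0\<close> and far away. A curve from one segment to the
  other that starts at distance \<open>a\<close> from the centre is at least \<open>a\<close> long. During the first \<open>a/2\<close>
  of its length it stays in \<open>|z| \<le> 3a/2\<close>, where \<open>\<sigma> \<ge> 2/a\<close>, so this initial piece alone contributes
  at least \<open>1\<close> to the line integral (\<open>line_integral_inverse_norm_density_ge_1\<close>). On the other hand
  each dyadic annulus contributes a bounded amount to the integral of \<open>\<sigma>\<^sup>2\<close>, which is therefore
  \<open>O(n)\<close> (\<open>nn_integral_inverse_norm_density_le\<close>). Hence \<open>1/\<lambda>\<close> is at least a constant over \<open>n + 2\<close>, while a
  Hoelder bound would force it below a constant times \<open>2\<close> to the power \<open>-\<alpha>n\<close>.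

  The line integral is taken along the arc-length parametrization, whose value at \<open>u\<close> is
  determined only if some parameter has length exactly \<open>u\<close> before it. This is why the continuity of the
  length function of a rectifiable curve is established first (\<open>continuous_on_curve_length\<close>).
\<close>

section \<open>The length function of a rectifiable curve\<close>

definition polygon_length :: "(real \<Rightarrow> 'a::metric_space) \<Rightarrow> real list \<Rightarrow> real" where
  "polygon_length \<gamma> ts = (\<Sum>i<length ts - 1. dist (\<gamma> (ts ! i)) (\<gamma> (ts ! Suc i)))"

lemma polygon_length_nonneg: "0 \<le> polygon_length \<gamma> ts"
  unfolding polygon_length_def by (intro sum_nonneg) auto

lemma polygon_length_simps [simp]:
  "polygon_length \<gamma> [] = 0"
  "polygon_length \<gamma> [x] = 0"
  "polygon_length \<gamma> (x # y # xs) = dist (\<gamma> x) (\<gamma> y) + polygon_length \<gamma> (y # xs)"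
  unfolding polygon_length_def by (simp_all add: sum.lessThan_Suc_shift del: sum.lessThan_Suc)

lemma polygon_length_split:
  "polygon_length \<gamma> (xs @ c # ys) = polygon_length \<gamma> (xs @ [c]) + polygon_length \<gamma> (c # ys)"
proof (induction xs)
  case (Cons x xs)
  then show ?case by (cases xs) auto
qed simp

lemma polygon_length_Cons_le: "polygon_length \<gamma> ys \<le> polygon_length \<gamma> (c # ys)"
  by (cases ys) auto

lemma polygon_length_append_le:
  "polygon_length \<gamma> xs + polygon_length \<gamma> ys \<le> polygon_length \<gamma> (xs @ ys)"
proof (induction xs)
  case (Cons x xs)
  then show ?case using polygon_length_Cons_le[of \<gamma> ys x] by (cases xs) auto
qed simp

lemma polygon_length_insert_le:
  "polygon_length \<gamma> (xs @ ys) \<le> polygon_length \<gamma> (xs @ c # ys)"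
proof (induction xs)
  case Nil
  then show ?case using polygon_length_Cons_le by simp
next
  case (Cons x xs)
  show ?case
  proof (cases xs)
    case Nil
    then show ?thesis using dist_triangle[of "\<gamma> x" _ "\<gamma> c"] by (cases ys) auto
  next
    case (Cons z zs)
    then show ?thesis using Cons.IH by auto
  qed
qed

lemma curve_length_eq_SUP_polygon_length:
  "curve_length \<gamma> a b = (SUP ts \<in> {ts. sorted ts \<and> set ts \<subseteq> {a..b}}. ennreal (polygon_length \<gamma> ts))"
  unfolding curve_length_def polygon_length_def by simp

lemma polygon_length_le_curve_length:
  "sorted ts \<Longrightarrow> set ts \<subseteq> {a..b} \<Longrightarrow> ennreal (polygon_length \<gamma> ts) \<le> curve_length \<gamma> a b"
  unfolding curve_length_eq_SUP_polygon_length by (rule SUP_upper) simp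

lemma dist_le_curve_length:
  "a \<le> b \<Longrightarrow> ennreal (dist (\<gamma> a) (\<gamma> b)) \<le> curve_length \<gamma> a b"
  using polygon_length_le_curve_length[of "[a, b]" a b \<gamma>] by simp

lemma curve_length_self [simp]: "curve_length \<gamma> a a = 0"
proof -
  have "polygon_length \<gamma> ts = 0" if "set ts \<subseteq> {a}" for ts
    using that by (induction ts rule: induct_list012) auto
  then show ?thesis
    unfolding curve_length_eq_SUP_polygon_length by (auto intro!: antisym SUP_least)
qed

lemma curve_length_mono:
  "a' \<le> a \<Longrightarrow> b \<le> b' \<Longrightarrow> curve_length \<gamma> a b \<le> curve_length \<gamma> a' b'"
  unfolding curve_length_def by (intro SUP_subset_mono) auto

text \<open>
  Inserting the point \<open>c\<close> into a partition of \<open>[a, b]\<close> does not shorten the inscribed polygon and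
  makes it split there; conversely, partitions of both halves concatenate to one of \<open>[a, b]\<close>.
\<close>

lemma curve_length_add:
  assumes "a \<le> c" "c \<le> b"
  shows "curve_length \<gamma> a b = curve_length \<gamma> a c + curve_length \<gamma> c b"
proof (rule antisym)
  show "curve_length \<gamma> a b \<le> curve_length \<gamma> a c + curve_length \<gamma> c b"
    unfolding curve_length_eq_SUP_polygon_length[of \<gamma> a b]
  proof (rule SUP_least, clarify)
    fix ts :: "real list"
    assume ts: "sorted ts" "set ts \<subseteq> {a..b}"
    define xs where "xs = takeWhile (\<lambda>t. t \<le> c) ts"
    define ys where "ys = dropWhile (\<lambda>t. t \<le> c) ts"
    have ts_eq: "ts = xs @ ys" by (simp add: xs_def ys_def)
    have xs_c: "t \<le> c" if "t \<in> set xs" for t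
      using that unfolding xs_def by (rule set_takeWhileD[THEN conjunct2])
    have xs: "sorted xs" and ys: "sorted ys"
      using ts(1) unfolding ts_eq sorted_append by blast+
    have mem: "t \<in> {a..b}" if "t \<in> set xs \<union> set ys" for t
      using that ts(2) unfolding ts_eq by auto
    have ys_c: "c \<le> t" if "t \<in> set ys" for t
    proof (cases ys)
      case Nil
      with that show ?thesis by simp
    next
      case (Cons z zs)
      then have "\<not> z \<le> c"
        using hd_dropWhile[of "\<lambda>t. t \<le> c" ts] unfolding ys_def by (metis list.sel(1) list.simps(3))
      then show ?thesis using that ys Cons by auto
    qed
    have "ennreal (polygon_length \<gamma> ts) \<le> ennreal (polygon_length \<gamma> (xs @ c # ys))"
      unfolding ts_eq by (intro ennreal_leI polygon_length_insert_le)
    also have "\<dots> = ennreal (polygon_length \<gamma> (xs @ [c])) + ennreal (polygon_length \<gamma> (c # ys))"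
      by (subst polygon_length_split) (simp add: polygon_length_nonneg)
    also have "\<dots> \<le> curve_length \<gamma> a c + curve_length \<gamma> c b"
    proof (intro add_mono polygon_length_le_curve_length)
      show "sorted (xs @ [c])" using xs xs_c by (simp add: sorted_append)
      show "set (xs @ [c]) \<subseteq> {a..c}" using xs_c mem assms by auto
      show "sorted (c # ys)" using ys ys_c by simp
      show "set (c # ys) \<subseteq> {c..b}" using ys_c mem assms by auto
    qed
    finally show "ennreal (polygon_length \<gamma> ts) \<le> curve_length \<gamma> a c + curve_length \<gamma> c b" .
  qed
next
  let ?S = "\<lambda>a b. {ts. sorted ts \<and> set ts \<subseteq> {a..b :: real}}"
  have ne: "?S a c \<noteq> {}" "?S c b \<noteq> {}" by (auto intro: exI[of _ "[]"])
  have seg: "ennreal (polygon_length \<gamma> xs) + ennreal (polygon_length \<gamma> ys) \<le> curve_length \<gamma> a b"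
    if "xs \<in> ?S a c" "ys \<in> ?S c b" for xs ys
  proof -
    have "ennreal (polygon_length \<gamma> xs) + ennreal (polygon_length \<gamma> ys)
        \<le> ennreal (polygon_length \<gamma> (xs @ ys))"
      using polygon_length_append_le[of \<gamma> xs ys]
      by (simp add: polygon_length_nonneg ennreal_leI flip: ennreal_plus)
    also have "\<dots> \<le> curve_length \<gamma> a b"
    proof (rule polygon_length_le_curve_length)
      have "x \<le> y" if "x \<in> set xs" "y \<in> set ys" for x y
        using that \<open>xs \<in> ?S a c\<close> \<open>ys \<in> ?S c b\<close> by fastforce
      then show "sorted (xs @ ys)" using that by (simp add: sorted_append)
      show "set (xs @ ys) \<subseteq> {a..b}" using that assms by auto
    qed
    finally show ?thesis .
  qed
  have "ennreal (polygon_length \<gamma> xs) + curve_length \<gamma> c b \<le> curve_length \<gamma> a b"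
    if "xs \<in> ?S a c" for xs
    unfolding curve_length_eq_SUP_polygon_length[of \<gamma> c b] ennreal_SUP_add_right[OF ne(2)]
    by (rule SUP_least) (rule seg[OF that])
  then show "curve_length \<gamma> a c + curve_length \<gamma> c b \<le> curve_length \<gamma> a b"
    unfolding curve_length_eq_SUP_polygon_length[of \<gamma> a c] ennreal_SUP_add_left[OF ne(1), symmetric]
    by (rule SUP_least)
qed

text \<open>
  For a fixed number of vertices the polygon length is a finite sum of distances; here \<open>c t\<close>
  perturbs the partition by an amount that dies out along the filter.
\<close>

lemma tendsto_polygon_length:
  assumes "\<And>x. x \<in> set ts \<Longrightarrow> ((\<lambda>t. \<gamma> (c t x)) \<longlongrightarrow> \<gamma> x) F"
  shows "((\<lambda>t. polygon_length \<gamma> (map (c t) ts)) \<longlongrightarrow> polygon_length \<gamma> ts) F"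
  using assms
proof (induction ts rule: induct_list012)
  case (3 x y zs)
  then have "((\<lambda>t. dist (\<gamma> (c t x)) (\<gamma> (c t y)) + polygon_length \<gamma> (map (c t) (y # zs)))
      \<longlongrightarrow> dist (\<gamma> x) (\<gamma> y) + polygon_length \<gamma> (y # zs)) F"
    by (intro tendsto_add tendsto_dist) auto
  then show ?case by simp
qed auto

text \<open>
  Length is a supremum of lengths of inscribed polygons, each of which varies continuously when its
  vertices are clamped to the moving interval. Both ends may move, so that the lemma serves for
  the length before a point as well as for the length after it.
\<close>

lemma curve_length_lower_semicontinuous:
  assumes cont: "continuous_on S \<gamma>" and ab: "{a..b} \<subseteq> S"
    and l: "(l \<longlongrightarrow> a) F" and u: "(u \<longlongrightarrow> b) F"
    and lu: "eventually (\<lambda>t. l t \<le> u t \<and> {l t..u t} \<subseteq> S) F"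
    and less: "r < curve_length \<gamma> a b"
  shows "eventually (\<lambda>t. r < curve_length \<gamma> (l t) (u t)) F"
proof -
  obtain ts where ts: "sorted ts" "set ts \<subseteq> {a..b}" "r < ennreal (polygon_length \<gamma> ts)"
    using less unfolding curve_length_eq_SUP_polygon_length less_SUP_iff by blast
  define c where "c t x = max (l t) (min (u t) x)" for t x
  have c_in: "c t x \<in> {l t..u t}" if "l t \<le> u t" for t x
    using that unfolding c_def by auto
  have "((\<lambda>t. \<gamma> (c t x)) \<longlongrightarrow> \<gamma> x) F" if "x \<in> set ts" for x
  proof (rule continuous_on_tendsto_compose[OF cont])
    have "((\<lambda>t. c t x) \<longlongrightarrow> max a (min b x)) F"
      unfolding c_def by (intro tendsto_intros l u)
    then show "((\<lambda>t. c t x) \<longlongrightarrow> x) F"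
      using ts(2) that by (auto simp: max_def min_def subset_iff split: if_splits)
    show "x \<in> S" using that ts(2) ab by blast
    show "eventually (\<lambda>t. c t x \<in> S) F"
      using lu by eventually_elim (use c_in in blast)
  qed
  then have "((\<lambda>t. ennreal (polygon_length \<gamma> (map (c t) ts))) \<longlongrightarrow> ennreal (polygon_length \<gamma> ts)) F"
    by (intro tendsto_ennrealI tendsto_polygon_length)
  then have "eventually (\<lambda>t. r < ennreal (polygon_length \<gamma> (map (c t) ts))) F"
    using ts(3) by (rule order_tendstoD(1))
  then show ?thesis
    using lu
  proof eventually_elim
    case (elim t)
    have "mono (c t)" unfolding c_def by (intro monoI) (auto simp: max_def min_def)
    then have "sorted (map (c t) ts)"
      unfolding sorted_map by (rule sorted_wrt_mono_rel[OF monoD ts(1)])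
    moreover have "set (map (c t) ts) \<subseteq> {l t..u t}"
      using elim c_in by auto
    ultimately show ?case
      using elim polygon_length_le_curve_length less_le_trans by blast
  qed
qed

text \<open>
  The length before \<open>t\<close> and the length after \<open>t\<close> are both lower semicontinuous in \<open>t\<close> and add up to
  the finite total length. So each is the total minus a lower semicontinuous function, hence also
  upper semicontinuous.
\<close>

lemma continuous_on_curve_length:
  assumes "rectifiable \<gamma>"
  shows "continuous_on {0..1} (\<lambda>t. curve_length \<gamma> 0 t)"
  unfolding continuous_on
proof (intro ballI order_tendstoI)
  have cont: "continuous_on {0..1} \<gamma>" and fin: "curve_length \<gamma> 0 1 < top"
    using assms by (auto simp: rectifiable_def path_def)
  fix s :: real and y :: ennreal
  assume s: "s \<in> {0..1}"
  have ev: "eventually (\<lambda>t. t \<in> {0..1}) (at s within {0..1})"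
    by (simp add: eventually_at_filter)
  have lim: "((\<lambda>t. t) \<longlongrightarrow> s) (at s within {0..1})" by (rule tendsto_ident_at)
  {
    assume "y < curve_length \<gamma> 0 s"
    then show "eventually (\<lambda>t. y < curve_length \<gamma> 0 t) (at s within {0..1})"
      by (rule curve_length_lower_semicontinuous[OF cont _ tendsto_const lim, rotated -1])
         (use s ev in \<open>auto elim: eventually_mono\<close>)
  next
    assume y: "curve_length \<gamma> 0 s < y"
    show "eventually (\<lambda>t. curve_length \<gamma> 0 t < y) (at s within {0..1})"
    proof (cases "y \<le> curve_length \<gamma> 0 1")
      case False
      then have "curve_length \<gamma> 0 t < y" if "t \<in> {0..1}" for t
        using that curve_length_mono[of 0 0 t 1 \<gamma>] by auto
      then show ?thesis using ev by (auto elim: eventually_mono)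
    next
      case True
      have yt: "y < top" using True fin by (rule le_less_trans)
      have split: "curve_length \<gamma> 0 t < y \<longleftrightarrow> curve_length \<gamma> 0 1 - y < curve_length \<gamma> t 1"
        if "t \<in> {0..1}" for t
      proof -
        have add: "curve_length \<gamma> 0 1 = curve_length \<gamma> 0 t + curve_length \<gamma> t 1"
          using that by (intro curve_length_add) auto
        then have "curve_length \<gamma> t 1 \<noteq> top" using fin by (auto simp: less_top)
        then show ?thesis
          unfolding minus_less_iff_ennreal[OF yt True]
          by (simp add: add ennreal_add_left_cancel_less add.commute[of _ "curve_length \<gamma> t 1"])
      qed
      have "eventually (\<lambda>t. curve_length \<gamma> 0 1 - y < curve_length \<gamma> t 1) (at s within {0..1})"
        using y split[OF s]
        by (intro curve_length_lower_semicontinuous[OF cont _ lim tendsto_const])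
           (use s ev in \<open>auto elim: eventually_mono\<close>)
      then show ?thesis
        using ev by eventually_elim (use split in blast)
    qed
  }
qed

text \<open>
  By the intermediate value theorem the parameter chosen in \<^const>\<open>arclength_param\<close> really
  has length \<open>u\<close> before it, and the chord is no longer than that arc.
\<close>

lemma dist_arclength_param_le:
  assumes "rectifiable \<gamma>" "0 \<le> u" "ennreal u \<le> curve_length \<gamma> 0 1"
  shows "dist (\<gamma> 0) (arclength_param \<gamma> u) \<le> u"
proof -
  have "\<exists>t. 0 \<le> t \<and> t \<le> 1 \<and> curve_length \<gamma> 0 t = ennreal u"
    by (rule IVT'[OF _ assms(3) _ continuous_on_curve_length[OF assms(1)]]) simp_all
  then have "\<exists>t. t \<in> {0..1} \<and> curve_length \<gamma> 0 t = ennreal u" by auto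
  from someI_ex[OF this] obtain t where t:
    "arclength_param \<gamma> u = \<gamma> t" "t \<in> {0..1}" "curve_length \<gamma> 0 t = ennreal u"
    unfolding arclength_param_def by blast
  then show ?thesis
    using dist_le_curve_length[of 0 t \<gamma>] assms(2) by simp
qed

section \<open>The modulus of the curves joining two opposite radial segments\<close>

text \<open>
  The cut-offs leave room for the initial pieces used below: a curve that starts at a distance
  \<open>a\<close> between \<open>2\<^sup>-\<^sup>n\<close> and \<open>1\<close> from the origin stays between \<open>a/2\<close> and \<open>3a/2\<close> there.
\<close>

definition inverse_norm_density :: "nat \<Rightarrow> real ^ 2 \<Rightarrow> ennreal" where
  "inverse_norm_density n z =
     (if (1/2) ^ Suc n \<le> norm z \<and> norm z \<le> 2 then ennreal (3 / norm z) else 0)"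

lemma inverse_norm_density_measurable [measurable]:
  "inverse_norm_density n \<in> borel_measurable borel"
  unfolding inverse_norm_density_def by measurable

lemma exists_dyadic_annulus:
  fixes a :: real
  assumes "(1/2) ^ N \<le> a" "a \<le> 2"
  shows "\<exists>k\<le>N. (1/2) ^ k \<le> a \<and> a \<le> 2 * (1/2) ^ k"
  using assms(1)
proof (induction N)
  case 0
  with assms(2) show ?case by auto
next
  case (Suc N)
  show ?case
  proof (cases "(1/2) ^ N \<le> a")
    case True
    with Suc.IH show ?thesis using le_SucI by blast
  next
    case False
    with Suc.prems show ?thesis by (intro exI[of _ "Suc N"]) auto
  qed
qed

text \<open>
  On the annulus \<open>2\<^sup>-\<^sup>k \<le> |z| \<le> 2 \<cdot> 2\<^sup>-\<^sup>k\<close> the squared density is at most \<open>9 \<cdot> 4\<^sup>k\<close>, and the enclosing disk has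
  area \<open>4\<pi> / 4\<^sup>k\<close>. So each of the \<open>n + 2\<close> annuli that meet the support contributes at most \<open>36\<pi>\<close>.
\<close>

lemma nn_integral_inverse_norm_density_le:
  "(\<integral>\<^sup>+ z. (inverse_norm_density n z)\<^sup>2 \<partial>lborel) \<le> ennreal (36 * pi * (n + 2))"
proof -
  let ?B = "\<lambda>k. cball (0 :: real ^ 2) (2 * (1/2) ^ k)"
  have "(inverse_norm_density n z)\<^sup>2 \<le> (\<Sum>k\<le>Suc n. ennreal (9 * 4 ^ k) * indicator (?B k) z)" for z
  proof (cases "(1/2) ^ Suc n \<le> norm z \<and> norm z \<le> 2")
    case True
    then obtain k where k: "k \<le> Suc n" "(1/2) ^ k \<le> norm z" "norm z \<le> 2 * (1/2) ^ k"
      using exists_dyadic_annulus by blast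
    have "3 / norm z \<le> 3 / (1/2) ^ k"
      using k(2) by (intro divide_left_mono mult_pos_pos less_le_trans[OF _ k(2)]) auto
    also have "\<dots> = 3 * 2 ^ k" by (simp add: power_divide)
    finally have "(3 / norm z)\<^sup>2 \<le> (3 * 2 ^ k)\<^sup>2" by (intro power_mono) auto
    also have "\<dots> = 9 * 4 ^ k"
      by (simp add: power_mult_distrib power2_eq_square flip: power_mult_distrib)
    finally have "(3 / norm z)\<^sup>2 \<le> 9 * 4 ^ k" .
    then have "(inverse_norm_density n z)\<^sup>2 \<le> ennreal (9 * 4 ^ k) * indicator (?B k) z"
      using True k(3) unfolding inverse_norm_density_def by (simp add: ennreal_power ennreal_leI)
    also have "\<dots> \<le> (\<Sum>k\<le>Suc n. ennreal (9 * 4 ^ k) * indicator (?B k) z)"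
      using k(1) by (intro member_le_sum) auto
    finally show ?thesis .
  next
    case False
    then have "inverse_norm_density n z = 0" unfolding inverse_norm_density_def by auto
    then show ?thesis by (simp del: sum.atMost_Suc)
  qed
  then have "(\<integral>\<^sup>+ z. (inverse_norm_density n z)\<^sup>2 \<partial>lborel)
      \<le> (\<integral>\<^sup>+ z. (\<Sum>k\<le>Suc n. ennreal (9 * 4 ^ k) * indicator (?B k) z) \<partial>lborel)"
    by (intro nn_integral_mono)
  also have "\<dots> = (\<Sum>k\<le>Suc n. ennreal (9 * 4 ^ k) * emeasure lborel (?B k))"
    by (subst nn_integral_sum)
       (auto simp: nn_integral_cmult_indicator borel_closed
             intro!: borel_measurable_times_ennreal borel_measurable_indicator)
  also have "\<dots> = (\<Sum>k\<le>Suc n. ennreal (36 * pi))"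
  proof (intro sum.cong refl)
    fix k
    have "emeasure lborel (?B k) = ennreal (pi * (2 * (1/2) ^ k)\<^sup>2)"
      by (simp add: emeasure_cball eval_unit_ball_vol)
    also have "(2 * (1/2) ^ k)\<^sup>2 = 4 / (4 :: real) ^ k"
      by (simp add: power2_eq_square power_divide flip: power_mult_distrib)
    finally show "ennreal (9 * 4 ^ k) * emeasure lborel (?B k) = ennreal (36 * pi)"
      by (simp flip: ennreal_mult)
  qed
  also have "\<dots> = ennreal (36 * pi * (n + 2))"
    by (subst sum_ennreal) (auto simp: algebra_simps)
  finally show ?thesis .
qed

text \<open>
  With \<open>a\<close> the norm of the starting point, the curve is at least \<open>a\<close> long, and up to arc length
  \<open>a/2\<close> it stays in \<open>a/2 \<le> |z| \<le> 3a/2\<close>. There the density is at least \<open>2/a\<close>, which integrates to \<open>1\<close>.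
\<close>

lemma line_integral_inverse_norm_density_ge_1:
  assumes rect: "rectifiable \<gamma>"
    and start: "(1/2) ^ n \<le> norm (\<gamma> 0)" "norm (\<gamma> 0) \<le> 1"
    and far: "norm (\<gamma> 0) \<le> dist (\<gamma> 0) (\<gamma> 1)"
  shows "1 \<le> line_integral (inverse_norm_density n) \<gamma>"
proof -
  define a where "a = norm (\<gamma> 0)"
  have a: "0 < a" using start(1) unfolding a_def by (rule less_le_trans[rotated]) simp
  define L where "L = enn2real (curve_length \<gamma> 0 1)"
  have L: "curve_length \<gamma> 0 1 = ennreal L"
    using rect unfolding L_def rectifiable_def by (simp add: less_top)
  have "ennreal a \<le> curve_length \<gamma> 0 1"
    using far dist_le_curve_length[of 0 1 \<gamma>] order_trans[OF ennreal_leI] unfolding a_def by auto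
  then have aL: "a \<le> L" unfolding L using a by (simp add: L_def)
  have ge: "ennreal (2 / a) \<le> inverse_norm_density n (arclength_param \<gamma> u)" if u: "u \<in> {0..a/2}" for u
  proof -
    let ?z = "arclength_param \<gamma> u"
    have "dist (\<gamma> 0) ?z \<le> a / 2"
      using dist_arclength_param_le[OF rect, of u] u aL a unfolding L by (auto simp: ennreal_leI)
    then have z: "a / 2 \<le> norm ?z" "norm ?z \<le> 3 * a / 2"
      using norm_triangle_ineq2[of "\<gamma> 0" ?z] norm_triangle_ineq2[of ?z "\<gamma> 0"]
      unfolding dist_norm a_def by (auto simp: norm_minus_commute)
    have "2 / a = 3 / (3 * a / 2)" by simp
    also have "\<dots> \<le> 3 / norm ?z" using z a by (intro divide_left_mono mult_pos_pos) auto
    finally show ?thesis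
      using z start unfolding inverse_norm_density_def a_def by (auto simp: ennreal_leI)
  qed
  have "(\<integral>\<^sup>+ u. ennreal (2 / a) * indicator {0..a/2} u \<partial>lborel)
      \<le> line_integral (inverse_norm_density n) \<gamma>"
    unfolding line_integral_def L_def[symmetric]
  proof (intro nn_integral_mono)
    fix u :: real
    show "ennreal (2 / a) * indicator {0..a/2} u
        \<le> inverse_norm_density n (arclength_param \<gamma> u) * indicator {0..L} u"
    proof (cases "u \<in> {0..a/2}")
      case True
      moreover from True have "u \<in> {0..L}" using a aL by auto
      ultimately show ?thesis using ge by simp
    qed simp
  qed
  moreover have "(\<integral>\<^sup>+ u. ennreal (2 / a) * indicator {0..a/2} u \<partial>lborel) = 1"
    using a by (simp add: nn_integral_cmult_indicator flip: ennreal_mult)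
  ultimately show ?thesis by simp
qed

text \<open>
  The radial segments from the two points to the circle are competitors in the infimum. Points on
  opposite rays are at least as far apart as each of them is from the origin, so the previous
  estimate applies to the joining curves, in whichever direction they run.
\<close>

lemma lambda_mod_antipodal_le:
  fixes e :: "real ^ 2"
  assumes e: "norm e = 1" and r_ge: "(1/2) ^ n \<le> r" and r_le: "r \<le> 1"
  shows "lambda_mod (ball 0 1) (r *\<^sub>R e) (- (r *\<^sub>R e)) \<le> ennreal (36 * pi * (n + 2))"
proof -
  define C where "C = (\<lambda>t. t *\<^sub>R e) ` {r..1}"
  have r: "0 < r" by (rule less_le_trans[OF _ r_ge]) simp
  have contC: "continuum C" "continuum (uminus ` C)"
    unfolding continuum_def C_def image_image using r_le
    by (intro conjI compact_continuous_image connected_continuous_image continuous_intros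
          compact_Icc connected_Icc; simp)+
  have norm_C: "r \<le> norm z" "norm z \<le> 1" if "z \<in> C \<union> uminus ` C" for z
    using that r e by (auto simp: C_def)
  have dist_C: "norm p \<le> dist p q" "norm q \<le> dist p q" if pq: "p \<in> C" "q \<in> uminus ` C" for p q
  proof -
    obtain s t where st: "p = s *\<^sub>R e" "q = - (t *\<^sub>R e)" "r \<le> s" "r \<le> t"
      using pq unfolding C_def image_image image_iff by (meson atLeastAtMost_iff)
    have pos: "0 < s" "0 < t" using st(3,4) r by linarith+
    have "dist p q = norm ((s + t) *\<^sub>R e)" by (simp add: st dist_norm scaleR_add_left)
    then show "norm p \<le> dist p q" "norm q \<le> dist p q" using st(1,2) pos e by auto
  qed
  have frontier: "e \<in> frontier (ball 0 1)" "- e \<in> frontier (ball 0 1)" using e by auto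
  have "e \<in> C" "r *\<^sub>R e \<in> C"
    using r_le by (auto simp: C_def intro!: image_eqI[of e _ 1])
  then have mem: "e \<in> C" "- e \<in> uminus ` C" "r *\<^sub>R e \<in> C" "- (r *\<^sub>R e) \<in> uminus ` C"
    by (auto simp only: imageI)
  have adm: "admissible (Delta C (uminus ` C) (ball 0 1)) (inverse_norm_density n)"
    unfolding admissible_def
  proof (intro conjI ballI impI)
    fix \<gamma> assume \<gamma>: "\<gamma> \<in> Delta C (uminus ` C) (ball 0 1)" "rectifiable \<gamma>"
    then have "(\<gamma> 0 \<in> C \<and> \<gamma> 1 \<in> uminus ` C) \<or> (\<gamma> 1 \<in> C \<and> \<gamma> 0 \<in> uminus ` C)"
      by (auto simp: Delta_def pathstart_def pathfinish_def)
    then have "r \<le> norm (\<gamma> 0) \<and> norm (\<gamma> 0) \<le> 1 \<and> norm (\<gamma> 0) \<le> dist (\<gamma> 0) (\<gamma> 1)"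
    proof (elim disjE conjE)
      assume "\<gamma> 0 \<in> C" "\<gamma> 1 \<in> uminus ` C"
      then show ?thesis using norm_C[of "\<gamma> 0"] dist_C(1) by blast
    next
      assume "\<gamma> 1 \<in> C" "\<gamma> 0 \<in> uminus ` C"
      then show ?thesis using norm_C[of "\<gamma> 0"] dist_C(2)[of "\<gamma> 1" "\<gamma> 0"]
        by (simp add: dist_commute)
    qed
    then show "1 \<le> line_integral (inverse_norm_density n) \<gamma>"
      using \<gamma>(2) by (intro line_integral_inverse_norm_density_ge_1) (use r_ge in auto)
  qed measurable
  have cl: "C \<subseteq> closure (ball 0 1)" "uminus ` C \<subseteq> closure (ball 0 1)"
    using norm_C(2) by auto
  have fr: "closure C \<inter> frontier (ball 0 1) \<noteq> {}" "closure (uminus ` C) \<inter> frontier (ball 0 1) \<noteq> {}"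
    using closure_subset[THEN subsetD, OF mem(1)] closure_subset[THEN subsetD, OF mem(2)] frontier
    by (meson disjoint_iff)+
  have "lambda_mod (ball 0 1) (r *\<^sub>R e) (- (r *\<^sub>R e))
      \<le> modulus (Delta C (uminus ` C) (ball 0 1))"
    unfolding lambda_mod_def
    by (rule INF_lower2[of "(C, uminus ` C)"], unfold mem_Collect_eq prod.case)
       (intro conjI contC cl mem fr, rule order_refl)
  also have "\<dots> \<le> (\<integral>\<^sup>+ z. (inverse_norm_density n z)\<^sup>2 \<partial>lborel)"
    using adm unfolding modulus_def by (intro INF_lower) simp
  also have "\<dots> \<le> ennreal (36 * pi * (n + 2))" by (rule nn_integral_inverse_norm_density_le)
  finally show ?thesis .
qed

section \<open>Comparison with the hyperbolic metric\<close>

lemma arsinh_le_self: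
  fixes x :: real
  assumes "0 \<le> x"
  shows "arsinh x \<le> x"
proof -
  \<comment> \<open>so that the argument of the logarithm is at most the quadratic Taylor polynomial of \<open>exp\<close>\<close>
  have "sqrt (x\<^sup>2 + 1) \<le> 1 + x\<^sup>2 / 2"
    by (rule real_le_lsqrt) (auto simp: power2_sum power_divide)
  then have "x + sqrt (x\<^sup>2 + 1) \<le> exp x"
    using exp_lower_Taylor_quadratic[OF assms] by linarith
  then have "ln (x + sqrt (x\<^sup>2 + 1)) \<le> ln (exp x)"
    using arsinh_real_aux[of x] by (subst ln_le_cancel_iff) auto
  then show ?thesis by (simp add: arsinh_real_def)
qed

lemma polynomial_times_geometric_powr_tendsto_0:
  fixes \<alpha> b :: real
  assumes "\<alpha> > 0" "b \<ge> 0"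
  shows "(\<lambda>n. (real n + 2) * (b * (1/2) ^ n) powr \<alpha>) \<longlonglongrightarrow> 0"
proof -
  define q where "q = (1/2 :: real) powr \<alpha>"
  have q: "\<bar>q\<bar> < 1"
    using assms powr_less_mono2[of \<alpha> "1/2" 1] by (simp add: q_def)
  have eq: "(b * (1/2) ^ n) powr \<alpha> = b powr \<alpha> * q ^ n" for n :: nat
  proof -
    have "((1/2 :: real) ^ n) powr \<alpha> = (1/2) powr (\<alpha> * n)"
      by (simp add: powr_powr mult.commute flip: powr_realpow)
    also have "\<dots> = q ^ n"
      by (simp add: q_def powr_powr flip: powr_realpow)
    finally show ?thesis using assms by (simp add: powr_mult)
  qed
  have "(\<lambda>n. real n * q ^ n) \<longlonglongrightarrow> 0" using q by (intro powser_times_n_limit_0) auto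
  moreover have "(\<lambda>n. q ^ n) \<longlonglongrightarrow> 0" using q by (intro LIMSEQ_power_zero) auto
  ultimately have "(\<lambda>n. b powr \<alpha> * (real n * q ^ n + 2 * q ^ n)) \<longlonglongrightarrow> b powr \<alpha> * (0 + 2 * 0)"
    by (intro tendsto_mult_left tendsto_add)
  then show ?thesis by (simp add: eq algebra_simps)
qed

lemma ennreal_inverse_antimono:
  fixes a b :: ennreal
  shows "a \<le> b \<Longrightarrow> inverse b \<le> inverse a"
  by (simp add: less_eq_ennreal.rep_eq inverse_ennreal.rep_eq ereal_inverse_antimono)

lemma hyp_dist_antipodal_le:
  fixes z :: "real ^ 2"
  assumes "norm z \<le> 1/2"
  shows "hyp_dist z (- z) \<le> 6 * norm z"
proof -
  have sq: "(norm z)\<^sup>2 \<le> (1/2)\<^sup>2" using assms by (intro power_mono) auto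
  then have pos: "3/4 \<le> 1 - (norm z)\<^sup>2" by (simp add: power2_eq_square)
  have "norm (z - - z) = 2 * norm z" by (simp flip: scaleR_2)
  then have "hyp_dist z (- z) = 2 * arsinh (2 * norm z / (1 - (norm z)\<^sup>2))"
    using pos unfolding hyp_dist_def by (simp add: abs_of_pos flip: power2_eq_square)
  also have "\<dots> \<le> 2 * (2 * norm z / (1 - (norm z)\<^sup>2))"
    using pos by (intro mult_left_mono arsinh_le_self) auto
  also have "\<dots> \<le> 2 * (2 * norm z / (3/4))"
    using pos by (intro mult_left_mono divide_left_mono) auto
  also have "\<dots> \<le> 6 * norm z" by simp
  finally show ?thesis .
qed

theorem corollary3p14:
  shows "\<not> (\<exists>C > 0. \<exists>\<alpha> > 0.
           \<forall>x \<in> ball (0 :: real ^ 2) 1. \<forall>y \<in> ball (0 :: real ^ 2) 1. x \<noteq> y \<longrightarrow>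
             lambda_inv (ball 0 1) x y \<le> ennreal (C * hyp_dist x y powr \<alpha>))"
proof (rule notI)
  assume "\<exists>C > 0. \<exists>\<alpha> > 0.
           \<forall>x \<in> ball (0 :: real ^ 2) 1. \<forall>y \<in> ball (0 :: real ^ 2) 1. x \<noteq> y \<longrightarrow>
             lambda_inv (ball 0 1) x y \<le> ennreal (C * hyp_dist x y powr \<alpha>)"
  then obtain C \<alpha> :: real where C: "C > 0" and \<alpha>: "\<alpha> > 0"
    and holder: "\<And>x y :: real ^ 2. x \<in> ball 0 1 \<Longrightarrow> y \<in> ball 0 1 \<Longrightarrow> x \<noteq> y \<Longrightarrow>
             lambda_inv (ball 0 1) x y \<le> ennreal (C * hyp_dist x y powr \<alpha>)"
    by blast
  obtain e :: "real ^ 2" where e: "norm e = 1"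
    using vector_choose_size[of 1] by auto
  have bound: "1 \<le> 36 * pi * C * ((real n + 2) * (6 * (1/2) ^ n) powr \<alpha>)" if n: "1 \<le> n" for n :: nat
  proof -
    define x where "x = (1/2 :: real) ^ n *\<^sub>R e"
    have norm_x: "norm x = (1/2) ^ n" using e by (simp add: x_def)
    have "(1/2 :: real) ^ n \<le> (1/2) ^ 1" using n by (intro power_decreasing) auto
    then have half: "norm x \<le> 1/2" unfolding norm_x by simp
    have "x \<noteq> 0" using norm_x by auto
    then have "x + x \<noteq> 0" by (simp flip: scaleR_2)
    then have x: "x \<in> ball 0 1" "- x \<in> ball 0 1" "x \<noteq> - x"
      using half by (auto simp: eq_neg_iff_add_eq_0)
    have "inverse (ennreal (36 * pi * (n + 2))) \<le> inverse (lambda_mod (ball 0 1) x (- x))"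
      unfolding x_def by (intro ennreal_inverse_antimono lambda_mod_antipodal_le e)
        (simp_all add: power_le_one)
    also have "\<dots> = lambda_inv (ball 0 1) x (- x)"
      using x(3) by (simp add: lambda_inv_def)
    also have "\<dots> \<le> ennreal (C * hyp_dist x (- x) powr \<alpha>)"
      using x by (rule holder)
    also have "\<dots> \<le> ennreal (C * (6 * norm x) powr \<alpha>)"
      using C \<alpha> x half hyp_dist_nonneg hyp_dist_antipodal_le
      by (intro ennreal_leI mult_left_mono powr_mono2) auto
    finally have inv: "inverse (36 * pi * (n + 2)) \<le> C * (6 * (1/2) ^ n) powr \<alpha>"
      using C by (simp add: inverse_ennreal norm_x)
    have pos: "0 < 36 * pi * (n + 2)" by simp
    show ?thesis
      using inv unfolding inverse_eq_divide pos_divide_le_eq[OF pos]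
      by (simp only: of_nat_add of_nat_numeral mult_ac)
  qed
  have "(\<lambda>n. 36 * pi * C * ((real n + 2) * (6 * (1/2) ^ n) powr \<alpha>)) \<longlonglongrightarrow> 36 * pi * C * 0"
    using \<alpha> by (intro tendsto_mult_left polynomial_times_geometric_powr_tendsto_0) auto
  moreover have "eventually (\<lambda>n. 1 \<le> 36 * pi * C * ((real n + 2) * (6 * (1/2) ^ n) powr \<alpha>)) sequentially"
    using bound by (rule eventually_sequentiallyI)
  ultimately have "1 \<le> 36 * pi * C * (0 :: real)"
    by (rule tendsto_lowerbound) simp
  then show False by simp
qed

end
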